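(* Let $n \geq 2$ and let $p > n$ be an odd prime. Let $w_1,\ldots,w_n$ be rational numbers with denominators prime to $p$ such that $w_1 \equiv Q_p(1) \pmod{p}$ and, for $\ell = 2,\ldots,n$, \[ w_\ell \equiv Q_p(1) + p\,w_{\ell-1} + \sum_{\nu=1}^{\ell-1} p^\nu\Bigl(\widehat\sigma_{\nu+1}(Q_p) + \binom{p-1}{\nu+1}(-1)^\nu\, w_{\ell-\nu}^{\nu+1}\Bigr) \pmod{p^\ell}. \] Then $W_p \equiv w_n \pmod{p^n}$.
   Context: $W_p = ((p-1)!+1)/p$ is the Wilson quotient, $q_p(a) = (a^{p-1}-1)/p$ the Fermat quotient, and $Q_p(m) = \sum_{a=1}^{p-1} q_p(a)^m$. Complete Bell polynomials: $B_k(y_1,\ldots,y_k) = \sum_{i=1}^k B_{k,i}$ where $B_{k,i}(y_1,\ldots,y_{k-i+1}) = \sum \frac{k!}{j_1!\cdots}\prod_{r}(y_r/r!)^{j_r}$ over nonnegative $j_r$ with $\sum r j_r = k$, $\sum j_r = i$. For $k \geq 1$, $\widehat\sigma_k(\pi_1,\ldots,\pi_k) = \frac{(-1)^k}{k!} B_k(-\pi_1, -1!\,\pi_2, \ldots, -(k-1)!\,\pi_k)$ (the expression of the $k$-th elementary symmetric polynomial in terms of power sums $\pi_1,\ldots,\pi_k$), and $\widehat\sigma_k(Q_p) = \widehat\sigma_k(Q_p(1),\ldots,Q_p(k))$. *)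

theory Defs
  imports Complex_Main "HOL-Computational_Algebra.Primes"
begin

definition p_integral :: "nat \<Rightarrow> rat \<Rightarrow> bool" where
  "p_integral p x \<longleftrightarrow> coprime (snd (quotient_of x)) (int p)"

text \<open>Congruence modulo the ideal generated by \<open>p ^ l\<close> in the ring of rationals with
  denominator prime to \<open>p\<close>.\<close>

definition p_cong :: "nat \<Rightarrow> nat \<Rightarrow> rat \<Rightarrow> rat \<Rightarrow> bool" where
  "p_cong p l x y \<longleftrightarrow> (\<exists>c. p_integral p c \<and> x - y = of_nat p ^ l * c)"

definition wilson_quotient :: "nat \<Rightarrow> rat" where
  "wilson_quotient p = (fact (p - 1) + 1) / of_nat p"

definition fermat_quotient :: "nat \<Rightarrow> nat \<Rightarrow> rat" where
  "fermat_quotient p a = (of_nat a ^ (p - 1) - 1) / of_nat p"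

definition fermat_power_sum :: "nat \<Rightarrow> nat \<Rightarrow> rat" where
  "fermat_power_sum p m = (\<Sum>a = 1..p - 1. fermat_quotient p a ^ m)"

text \<open>The exponent tuples \<open>(j\<^sub>1, \<dots>, j\<^sub>k\<^sub>-\<^sub>i\<^sub>+\<^sub>1)\<close> are functions on the naturals that vanish
  outside \<open>{1..k - i + 1}\<close>; a sequence \<open>y\<close> is likewise indexed from 1, its value at 0 being
  irrelevant.\<close>

definition bell_indices :: "nat \<Rightarrow> nat \<Rightarrow> (nat \<Rightarrow> nat) set" where
  "bell_indices k i = {j. (\<forall>r. r \<notin> {1..k - i + 1} \<longrightarrow> j r = 0) \<and>
     (\<Sum>r = 1..k - i + 1. r * j r) = k \<and> (\<Sum>r = 1..k - i + 1. j r) = i}"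

lemma finite_bell_indices: "finite (bell_indices k i)"
proof (rule finite_subset)
  let ?R = "{1..k - i + 1}"
  show "bell_indices k i \<subseteq> {j. \<forall>r. (r \<in> ?R \<longrightarrow> j r \<in> {..i}) \<and> (r \<notin> ?R \<longrightarrow> j r = 0)}"
  proof
    fix j assume j: "j \<in> bell_indices k i"
    have "j r \<le> i" if "r \<in> ?R" for r
      using member_le_sum[of r ?R j] that j by (auto simp: bell_indices_def)
    with j show "j \<in> {j. \<forall>r. (r \<in> ?R \<longrightarrow> j r \<in> {..i}) \<and> (r \<notin> ?R \<longrightarrow> j r = 0)}"
      by (auto simp: bell_indices_def)
  qed
  show "finite {j. \<forall>r. (r \<in> ?R \<longrightarrow> j r \<in> {..i}) \<and> (r \<notin> ?R \<longrightarrow> j r = 0)}"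
    by (rule finite_set_of_finite_funs) auto
qed

definition partial_bell :: "nat \<Rightarrow> nat \<Rightarrow> (nat \<Rightarrow> rat) \<Rightarrow> rat" where
  "partial_bell k i y = (\<Sum>j \<in> bell_indices k i.
     fact k / (\<Prod>r = 1..k - i + 1. fact (j r)) * (\<Prod>r = 1..k - i + 1. (y r / fact r) ^ j r))"

definition complete_bell :: "nat \<Rightarrow> (nat \<Rightarrow> rat) \<Rightarrow> rat" where
  "complete_bell k y = (\<Sum>i = 1..k. partial_bell k i y)"

definition sigma_hat :: "nat \<Rightarrow> (nat \<Rightarrow> rat) \<Rightarrow> rat" where
  "sigma_hat k \<pi> = (- 1) ^ k / fact k * complete_bell k (\<lambda>r. - (fact (r - 1) * \<pi> r))"

end

theory Submission
  imports Defs "HOL-Number_Theory.Residues" "HOL-Computational_Algebra.Polynomial_FPS"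
begin

text \<open>
  Multiplying the identities \<open>a ^ (p - 1) = 1 + p q\<^sub>p(a)\<close> over \<open>a\<close> and using
  \<open>(p - 1)! = p W\<^sub>p - 1\<close> gives \<open>\<Prod>\<^sub>a (1 + p q\<^sub>p(a)) = (1 - p W\<^sub>p) ^ (p - 1)\<close>. Expanding the left side by
  elementary symmetric polynomials of the Fermat quotients, the right side by the binomial theorem,
  and dividing by \<open>p\<close> shows that \<open>W\<^sub>p\<close> is an exact fixed point of the (untruncated) recursion.
  Modulo \<open>p ^ l\<close> the terms with \<open>\<nu> \<ge> l\<close> vanish, and the factor \<open>p ^ \<nu>\<close> makes the approximation of
  \<open>W\<^sub>p\<close> modulo \<open>p ^ (l - \<nu>)\<close> sufficient. The Bell polynomial expression and the elementary
  symmetric polynomials agree because both satisfy Newton's recursion.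
\<close>

section \<open>Rationals with denominator prime to p\<close>

text \<open>The reduced denominator divides every integer \<open>b\<close> with \<open>b * x\<close>
  integral, so any such \<open>b\<close> prime to \<open>p\<close> is as good a witness. This form
  is easily combined under sums and products, where reduced denominators are not.\<close>

lemma p_integral_iff:
  "p_integral p x \<longleftrightarrow> (\<exists>b::int. b \<noteq> 0 \<and> coprime b (int p) \<and> of_int b * x \<in> \<int>)"
proof -
  obtain n d where q: "quotient_of x = (n, d)" by fastforce
  have d: "d > 0" and nd: "coprime n d" and x: "x = of_int n / of_int d"
    using quotient_of_denom_pos[OF q] quotient_of_coprime[OF q] quotient_of_div[OF q] by auto
  show ?thesis
  proof
    assume "p_integral p x"
    then have "coprime d (int p)" by (simp add: p_integral_def q)
    moreover have "of_int d * x \<in> \<int>" using d x by simp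
    ultimately show "\<exists>b::int. b \<noteq> 0 \<and> coprime b (int p) \<and> of_int b * x \<in> \<int>"
      using d by (intro exI[of _ d]) simp
  next
    assume "\<exists>b::int. b \<noteq> 0 \<and> coprime b (int p) \<and> of_int b * x \<in> \<int>"
    then obtain b z :: int where b: "b \<noteq> 0" "coprime b (int p)" "of_int b * x = of_int z"
      by (auto elim!: Ints_cases)
    then have "(of_int (b * n) :: rat) = of_int (z * d)"
      using d by (simp add: x field_simps)
    then have "b * n = z * d" by (simp only: of_int_eq_iff)
    then have "d dvd b * n" by simp
    then have "d dvd b"
      using nd by (simp add: coprime_commute coprime_dvd_mult_left_iff)
    then have "coprime d (int p)" using b(2) coprime_divisors[of d b "int p" "int p"] by simp
    then show "p_integral p x" by (simp add: p_integral_def q)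
  qed
qed

lemma p_integral_Ints: "x \<in> \<int> \<Longrightarrow> p_integral p x"
  unfolding p_integral_iff by (rule exI[of _ 1]) auto

lemma p_integral_add:
  assumes "p_integral p x" "p_integral p y"
  shows "p_integral p (x + y)"
proof -
  obtain b c :: int where b: "b \<noteq> 0" "coprime b (int p)" "of_int b * x \<in> \<int>"
    and c: "c \<noteq> 0" "coprime c (int p)" "of_int c * y \<in> \<int>"
    using assms unfolding p_integral_iff by blast
  have "of_int (b * c) * (x + y) = of_int c * (of_int b * x) + of_int b * (of_int c * y)"
    by (simp add: algebra_simps)
  also have "\<dots> \<in> \<int>" using b(3) c(3) by (blast intro: Ints_add Ints_mult Ints_of_int)
  finally have "of_int (b * c) * (x + y) \<in> \<int>" .
  moreover have "b * c \<noteq> 0" "coprime (b * c) (int p)" using b c by auto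
  ultimately show ?thesis unfolding p_integral_iff by blast
qed

lemma p_integral_mult:
  assumes "p_integral p x" "p_integral p y"
  shows "p_integral p (x * y)"
proof -
  obtain b c :: int where b: "b \<noteq> 0" "coprime b (int p)" "of_int b * x \<in> \<int>"
    and c: "c \<noteq> 0" "coprime c (int p)" "of_int c * y \<in> \<int>"
    using assms unfolding p_integral_iff by blast
  have "of_int (b * c) * (x * y) = (of_int b * x) * (of_int c * y)"
    by (simp add: algebra_simps)
  also have "\<dots> \<in> \<int>" using b(3) c(3) by (rule Ints_mult)
  finally have "of_int (b * c) * (x * y) \<in> \<int>" .
  moreover have "b * c \<noteq> 0" "coprime (b * c) (int p)" using b c by auto
  ultimately show ?thesis unfolding p_integral_iff by blast
qed

lemma p_integral_power: "p_integral p x \<Longrightarrow> p_integral p (x ^ k)"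
  by (induction k) (auto intro: p_integral_mult p_integral_Ints)

section \<open>Congruences modulo powers of p\<close>

lemma p_cong_refl: "p_cong p l x x"
  unfolding p_cong_def by (rule exI[of _ 0]) (simp add: p_integral_Ints)

lemma p_cong_sym:
  assumes "p_cong p l x y"
  shows "p_cong p l y x"
proof -
  obtain c where "p_integral p c" "x - y = of_nat p ^ l * c"
    using assms unfolding p_cong_def by blast
  then have "p_integral p ((- 1) * c)" "y - x = of_nat p ^ l * ((- 1) * c)"
    by (auto intro!: p_integral_mult[OF p_integral_Ints] simp del: mult_minus1 mult_minus1_right mult_minus_left)
  then show ?thesis unfolding p_cong_def by blast
qed

lemma p_cong_add:
  assumes "p_cong p l x y" "p_cong p l x' y'"
  shows "p_cong p l (x + x') (y + y')"
proof -
  obtain c c' where "p_integral p c" "x - y = of_nat p ^ l * c"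
    and "p_integral p c'" "x' - y' = of_nat p ^ l * c'"
    using assms unfolding p_cong_def by blast
  then have "p_integral p (c + c')" "x + x' - (y + y') = of_nat p ^ l * (c + c')"
    by (auto intro!: p_integral_add simp: algebra_simps)
  then show ?thesis unfolding p_cong_def by blast
qed

lemma p_cong_trans:
  assumes "p_cong p l x y" "p_cong p l y z"
  shows "p_cong p l x z"
proof -
  obtain c c' where "p_integral p c" "x - y = of_nat p ^ l * c"
    and "p_integral p c'" "y - z = of_nat p ^ l * c'"
    using assms unfolding p_cong_def by blast
  then have "p_integral p (c + c')" "x - z = of_nat p ^ l * (c + c')"
    by (auto intro!: p_integral_add simp: algebra_simps)
  then show ?thesis unfolding p_cong_def by blast
qed

text \<open>The splitting \<open>x * x' - y * y' = x * (x' - y') + (x - y) * y'\<close> is why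
  integrality is asked of \<open>x\<close> and \<open>y'\<close>.\<close>

lemma p_cong_mult:
  assumes "p_cong p l x y" "p_cong p l x' y'" "p_integral p x" "p_integral p y'"
  shows "p_cong p l (x * x') (y * y')"
proof -
  obtain c c' where c: "p_integral p c" "x - y = of_nat p ^ l * c"
    and c': "p_integral p c'" "x' - y' = of_nat p ^ l * c'"
    using assms unfolding p_cong_def by blast
  have "x * x' - y * y' = x * (x' - y') + (x - y) * y'" by (simp add: algebra_simps)
  also have "\<dots> = of_nat p ^ l * (x * c' + c * y')"
    unfolding c c' by (simp add: algebra_simps)
  finally have "x * x' - y * y' = of_nat p ^ l * (x * c' + c * y')" .
  moreover have "p_integral p (x * c' + c * y')"
    using assms c(1) c'(1) by (intro p_integral_add p_integral_mult)
  ultimately show ?thesis unfolding p_cong_def by blast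
qed

lemma p_cong_power:
  assumes "p_cong p l x y" "p_integral p x" "p_integral p y"
  shows "p_cong p l (x ^ k) (y ^ k)"
  by (induction k) (auto intro: p_cong_refl p_cong_mult p_integral_power assms)

lemma p_cong_sum:
  "(\<And>i. i \<in> A \<Longrightarrow> p_cong p l (f i) (g i)) \<Longrightarrow> p_cong p l (sum f A) (sum g A)"
  by (induction A rule: infinite_finite_induct) (auto intro: p_cong_add p_cong_refl)

text \<open>Compensates the loss of precision in the recursion: the term with factor
  \<open>p ^ \<nu>\<close> involves \<open>w (l - \<nu>)\<close>, which is controlled only modulo
  \<open>p ^ (l - \<nu>)\<close>.\<close>

lemma p_cong_p_power_mult:
  assumes "p_cong p l x y"
  shows "p_cong p (m + l) (of_nat p ^ m * x) (of_nat p ^ m * y)"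
proof -
  obtain c where "p_integral p c" "x - y = of_nat p ^ l * c"
    using assms unfolding p_cong_def by blast
  moreover from this(2) have "of_nat p ^ m * x - of_nat p ^ m * y = of_nat p ^ (m + l) * c"
    by (simp add: power_add algebra_simps flip: right_diff_distrib)
  ultimately show ?thesis unfolding p_cong_def by blast
qed

lemma p_cong_0_p_power_mult:
  assumes "l \<le> m" "p_integral p x"
  shows "p_cong p l (of_nat p ^ m * x) 0"
proof -
  have "of_nat p ^ m * x - 0 = of_nat p ^ l * (of_nat p ^ (m - l) * x)"
    using assms(1) by (simp flip: power_add mult.assoc)
  moreover have "p_integral p (of_nat p ^ (m - l) * x)"
    using assms(2) by (intro p_integral_mult[OF p_integral_Ints]) auto
  ultimately show ?thesis unfolding p_cong_def by blast
qed

section \<open>Bell polynomials\<close>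

text \<open>These are the partitions of \<open>k\<close> into parts of size at most
  \<open>N\<close>, with \<open>j r\<close> the multiplicity of \<open>r\<close>. Unlike in
  \<open>bell_indices\<close>, the range does not depend on the number of parts, so a part can be
  added or removed within the same range.\<close>

definition partition_exponents :: "nat \<Rightarrow> nat \<Rightarrow> (nat \<Rightarrow> nat) set" where
  "partition_exponents N k =
     {j. (\<forall>r. r \<notin> {1..N} \<longrightarrow> j r = 0) \<and> (\<Sum>r = 1..N. r * j r) = k}"

text \<open>The contribution of \<open>j\<close>, without its power of \<open>t\<close>, when the
  exponential series of \<open>x r * t ^ r\<close> are multiplied out.\<close>

definition exponent_term :: "nat \<Rightarrow> (nat \<Rightarrow> 'a::field_char_0) \<Rightarrow> (nat \<Rightarrow> nat) \<Rightarrow> 'a" where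
  "exponent_term N x j = (\<Prod>r = 1..N. x r ^ j r / fact (j r))"

text \<open>For \<open>N \<ge> k\<close>, this is the \<open>k\<close>-th coefficient of \<open>exp (\<Sum>r. x\<^sub>r t ^ r)\<close>.\<close>

definition exp_coeff :: "nat \<Rightarrow> (nat \<Rightarrow> 'a::field_char_0) \<Rightarrow> nat \<Rightarrow> 'a" where
  "exp_coeff N x k = (\<Sum>j \<in> partition_exponents N k. exponent_term N x j)"

section \<open>Recurrence for the coefficients of the exponential\<close>

lemma partition_exponents_mult_le:
  assumes "j \<in> partition_exponents N k"
  shows "r * j r \<le> k"
proof (cases "r \<in> {1..N}")
  case True
  then show ?thesis
    using member_le_sum[of r "{1..N}" "\<lambda>r. r * j r"] assms by (auto simp: partition_exponents_def)
next
  case False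
  then show ?thesis using assms by (auto simp: partition_exponents_def)
qed

lemma finite_partition_exponents: "finite (partition_exponents N k)"
proof (rule finite_subset)
  show "partition_exponents N k \<subseteq>
      {j. \<forall>r. (r \<in> {1..N} \<longrightarrow> j r \<in> {..k}) \<and> (r \<notin> {1..N} \<longrightarrow> j r = 0)}"
  proof
    fix j assume j: "j \<in> partition_exponents N k"
    have "j r \<le> k" if "r \<in> {1..N}" for r
    proof -
      have "j r \<le> r * j r" using that by simp
      then show ?thesis using partition_exponents_mult_le[OF j, of r] by linarith
    qed
    with j show "j \<in> {j. \<forall>r. (r \<in> {1..N} \<longrightarrow> j r \<in> {..k}) \<and> (r \<notin> {1..N} \<longrightarrow> j r = 0)}"
      by (auto simp: partition_exponents_def)
  qed
  show "finite {j. \<forall>r. (r \<in> {1..N} \<longrightarrow> j r \<in> {..k}) \<and> (r \<notin> {1..N} \<longrightarrow> j r = 0)}"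
    by (rule finite_set_of_finite_funs) auto
qed

lemma exponent_term_Suc:
  assumes "r \<in> {1..N}"
  shows "of_nat (Suc (j r)) * exponent_term N x (j(r := Suc (j r))) = x r * exponent_term N x j"
proof -
  have *: "(\<Prod>s \<in> {1..N} - {r}. x s ^ (j(r := Suc (j r))) s / fact ((j(r := Suc (j r))) s)) =
      (\<Prod>s \<in> {1..N} - {r}. x s ^ j s / fact (j s))"
    by (rule prod.cong) auto
  have "(of_nat (Suc (j r)) :: 'a) \<noteq> 0" by (simp only: of_nat_eq_0_iff)
  then show ?thesis
    unfolding exponent_term_def using assms
    by (subst (1 2) prod.remove[of _ r]) (simp_all only: * finite_atLeastAtMost, simp del: of_nat_Suc)
qed

lemma weight_Suc:
  assumes "r \<in> {1..N}"
  shows "(\<Sum>s = 1..N. s * (j(r := Suc (j r))) s) = (\<Sum>s = 1..N. s * j s) + r"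
proof -
  have *: "(\<Sum>s \<in> {1..N} - {r}. s * (j(r := Suc (j r))) s) = (\<Sum>s \<in> {1..N} - {r}. s * j s)"
    by (rule sum.cong) auto
  show ?thesis
    using assms by (subst (1 2) sum.remove[of _ r]) (simp_all only: * finite_atLeastAtMost, simp)
qed

text \<open>Removing one part \<open>r\<close> is a bijection from the partitions of
  \<open>k\<close> that contain \<open>r\<close> onto the partitions of \<open>k - r\<close>. The
  weight \<open>j r\<close> discards the partitions without \<open>r\<close> and cancels against the
  factorial.\<close>

lemma sum_partition_exponents_shift:
  assumes "r \<in> {1..k}" "k \<le> N"
  shows "(\<Sum>j \<in> partition_exponents N k. of_nat (j r) * exponent_term N x j) =
    x r * exp_coeff N x (k - r)"
proof -
  have r: "r \<in> {1..N}" using assms by auto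
  have "(\<Sum>j \<in> partition_exponents N k. of_nat (j r) * exponent_term N x j) =
      (\<Sum>j \<in> {j \<in> partition_exponents N k. j r > 0}. of_nat (j r) * exponent_term N x j)"
    by (rule sum.mono_neutral_right) (auto simp: finite_partition_exponents)
  also have "\<dots> = (\<Sum>j \<in> partition_exponents N (k - r).
      of_nat (Suc (j r)) * exponent_term N x (j(r := Suc (j r))))"
  proof (rule sum.reindex_bij_witness[where i = "\<lambda>j. j(r := Suc (j r))"
        and j = "\<lambda>j. j(r := j r - 1)"])
    fix j assume j: "j \<in> {j \<in> partition_exponents N k. j r > 0}"
    let ?j = "j(r := j r - 1)"
    have eq: "?j(r := Suc (?j r)) = j" using j by auto
    then show "?j(r := Suc (?j r)) = j" .
    show "of_nat (Suc (?j r)) * exponent_term N x (?j(r := Suc (?j r))) =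
        of_nat (j r) * exponent_term N x j"
      unfolding eq using j by simp
    show "?j \<in> partition_exponents N (k - r)"
      using j weight_Suc[OF r, of ?j] unfolding eq by (auto simp: partition_exponents_def)
  next
    fix j assume j: "j \<in> partition_exponents N (k - r)"
    let ?j = "j(r := Suc (j r))"
    show "?j(r := ?j r - 1) = j" by auto
    show "?j \<in> {j \<in> partition_exponents N k. j r > 0}"
      using j r assms weight_Suc[OF r, of j] by (auto simp: partition_exponents_def)
  qed
  also have "\<dots> = x r * exp_coeff N x (k - r)"
    unfolding exp_coeff_def sum_distrib_left by (intro sum.cong refl exponent_term_Suc r)
  finally show ?thesis .
qed

text \<open>The coefficient form of F' = F * (\<Sum>r. r x_r t^(r-1)) for F = exp (\<Sum>r. x_r
  t^r). It is proved without derivatives, by expanding the weight \<open>k\<close> of each partition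
  as the sum of all \<open>r * j r\<close> and exchanging the sums.\<close>

lemma exp_coeff_recurrence:
  assumes "k \<le> N"
  shows "of_nat k * exp_coeff N x k = (\<Sum>r = 1..k. of_nat r * x r * exp_coeff N x (k - r))"
proof -
  have "of_nat k * exp_coeff N x k =
      (\<Sum>j \<in> partition_exponents N k. \<Sum>r = 1..k. of_nat r * (of_nat (j r) * exponent_term N x j))"
    unfolding exp_coeff_def sum_distrib_left
  proof (rule sum.cong[OF refl])
    fix j assume j: "j \<in> partition_exponents N k"
    have "k = (\<Sum>r = 1..N. r * j r)" using j by (auto simp: partition_exponents_def)
    also have "\<dots> = (\<Sum>r = 1..k. r * j r)"
    \<comment> \<open>A part larger than \<open>k\<close> cannot occur in a partition of
      \<open>k\<close>.\<close>
    proof (rule sum.mono_neutral_right)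
      show "\<forall>r \<in> {1..N} - {1..k}. r * j r = 0"
      proof
        fix r assume "r \<in> {1..N} - {1..k}"
        then show "r * j r = 0" using partition_exponents_mult_le[OF j, of r] by (cases "j r") auto
      qed
    qed (use assms in auto)
    finally have "(of_nat k :: 'a) = of_nat (\<Sum>r = 1..k. r * j r)" by simp
    then have "of_nat k * exponent_term N x j =
        of_nat (\<Sum>r = 1..k. r * j r) * exponent_term N x j" by simp
    then show "of_nat k * exponent_term N x j =
        (\<Sum>r = 1..k. of_nat r * (of_nat (j r) * exponent_term N x j))"
      by (simp add: sum_distrib_right mult.assoc)
  qed
  also have "\<dots> = (\<Sum>r = 1..k. of_nat r *
      (\<Sum>j \<in> partition_exponents N k. of_nat (j r) * exponent_term N x j))"
    by (subst sum.swap) (simp add: sum_distrib_left)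
  also have "\<dots> = (\<Sum>r = 1..k. of_nat r * x r * exp_coeff N x (k - r))"
    by (intro sum.cong refl) (simp only: sum_partition_exponents_shift[OF _ assms] mult.assoc)
  finally show ?thesis .
qed

lemma exp_coeff_0: "exp_coeff N x 0 = 1"
proof -
  have "partition_exponents N 0 = {\<lambda>_. 0}"
    unfolding partition_exponents_def by (auto simp: fun_eq_iff) (metis atLeastAtMost_iff One_nat_def)
  then show ?thesis by (simp add: exp_coeff_def exponent_term_def)
qed

section \<open>Complete Bell polynomials as exponential coefficients\<close>

text \<open>An index \<open>r > k - i + 1\<close> with \<open>j r > 0\<close> would force
  \<open>(\<Sum>s. s * j s) \<ge> r + (i - 1) > k\<close>.\<close>

lemma bell_indices_eq:
  assumes "1 \<le> i" "i \<le> k" "k \<le> N"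
  shows "bell_indices k i = {j \<in> partition_exponents N k. (\<Sum>r = 1..N. j r) = i}"
proof (intro equalityI subsetI)
  fix j assume j: "j \<in> bell_indices k i"
  have "(\<Sum>r = 1..N. r * j r) = (\<Sum>r = 1..k - i + 1. r * j r)"
    using j assms by (intro sum.mono_neutral_right) (auto simp: bell_indices_def)
  moreover have "(\<Sum>r = 1..N. j r) = (\<Sum>r = 1..k - i + 1. j r)"
    using j assms by (intro sum.mono_neutral_right) (auto simp: bell_indices_def)
  moreover have "\<forall>r. r \<notin> {1..N} \<longrightarrow> j r = 0"
    using j assms by (auto simp: bell_indices_def)
  ultimately show "j \<in> {j \<in> partition_exponents N k. (\<Sum>r = 1..N. j r) = i}"
    using j unfolding bell_indices_def partition_exponents_def mem_Collect_eq by metis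
next
  fix j assume j: "j \<in> {j \<in> partition_exponents N k. (\<Sum>r = 1..N. j r) = i}"
  have z: "j r = 0" if r: "r \<notin> {1..k - i + 1}" for r
  proof (rule ccontr)
    assume "j r \<noteq> 0"
    then have rN: "r \<in> {1..N}" using j by (auto simp: partition_exponents_def)
    then have rk: "r > k - i + 1" using r by auto
    have "i = j r + (\<Sum>s \<in> {1..N} - {r}. j s)"
      using j rN sum.remove[of "{1..N}" r j] by simp
    moreover have "k = r * j r + (\<Sum>s \<in> {1..N} - {r}. s * j s)"
      using j rN sum.remove[of "{1..N}" r "\<lambda>s. s * j s"] by (simp add: partition_exponents_def)
    moreover have "(\<Sum>s \<in> {1..N} - {r}. j s) \<le> (\<Sum>s \<in> {1..N} - {r}. s * j s)"
      by (rule sum_mono) auto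
    moreover have "r * j r \<ge> r + (j r - 1)"
    proof -
      obtain m where "j r = Suc m" using \<open>j r \<noteq> 0\<close> by (cases "j r") auto
      then show ?thesis using rN by simp
    qed
    ultimately show False using rk \<open>j r \<noteq> 0\<close> assms by linarith
  qed
  have "(\<Sum>r = 1..N. r * j r) = (\<Sum>r = 1..k - i + 1. r * j r)"
    using z assms by (intro sum.mono_neutral_right) auto
  moreover have "(\<Sum>r = 1..N. j r) = (\<Sum>r = 1..k - i + 1. j r)"
    using z assms by (intro sum.mono_neutral_right) auto
  ultimately show "j \<in> bell_indices k i"
    using j z unfolding bell_indices_def partition_exponents_def mem_Collect_eq by metis
qed

text \<open>Sorting the partitions of \<open>k\<close> by their number of parts \<open>i\<close>
  merges the partial Bell polynomials into one sum.\<close>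

lemma complete_bell_eq_exp_coeff:
  assumes "1 \<le> k" "k \<le> N"
  shows "complete_bell k y = fact k * exp_coeff N (\<lambda>r. y r / fact r) k"
proof -
  let ?x = "\<lambda>r. y r / fact r"
  let ?J = "\<lambda>i. {j. j \<in> partition_exponents N k \<and> (\<Sum>r = 1..N. j r) = i}"
  have part: "partial_bell k i y = (\<Sum>j \<in> ?J i. fact k * exponent_term N ?x j)"
    if i: "i \<in> {1..k}" for i
    unfolding partial_bell_def
  proof (rule sum.cong)
    show "bell_indices k i = ?J i" using bell_indices_eq[of i k N] i assms by auto
    fix j assume "j \<in> ?J i"
    then have j: "j \<in> bell_indices k i" using bell_indices_eq[of i k N] i assms by auto
    have "exponent_term N ?x j = (\<Prod>r = 1..k - i + 1. ?x r ^ j r / fact (j r))"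
      unfolding exponent_term_def
      \<comment> \<open>Beyond \<open>k - i + 1\<close> the exponents are 0, so each factor is
        1.\<close>
      using j i assms by (intro prod.mono_neutral_right) (auto simp: bell_indices_def)
    then show "fact k / (\<Prod>r = 1..k - i + 1. fact (j r)) * (\<Prod>r = 1..k - i + 1. ?x r ^ j r) =
        fact k * exponent_term N ?x j"
      by (simp add: prod_dividef)
  qed
  \<comment> \<open>As \<open>k\<close> is positive, every partition has at least one part; hence
    the range \<open>i = 1..k\<close> misses none.\<close>
  have "(\<Sum>r = 1..N. j r) \<in> {1..k}" if j: "j \<in> partition_exponents N k" for j
  proof -
    have "(\<Sum>r = 1..N. j r) \<le> (\<Sum>r = 1..N. r * j r)" by (rule sum_mono) auto
    moreover have "(\<Sum>r = 1..N. j r) \<noteq> 0"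
    proof
      assume "(\<Sum>r = 1..N. j r) = 0"
      then have "(\<Sum>r = 1..N. r * j r) = 0" by simp
      then show False using j assms by (simp add: partition_exponents_def)
    qed
    ultimately show ?thesis using j by (simp add: partition_exponents_def del: sum_eq_0_iff)
  qed
  then have "(\<Sum>i = 1..k. \<Sum>j \<in> ?J i. fact k * exponent_term N ?x j) =
      (\<Sum>j \<in> partition_exponents N k. fact k * exponent_term N ?x j)"
    by (intro sum.group finite_partition_exponents) auto
  then show ?thesis
    unfolding complete_bell_def exp_coeff_def sum_distrib_left using part by simp
qed

section \<open>Newton's identities\<close>

text \<open>Taking coefficients of the generating polynomial, rather than sums over subsets, makes
  both evaluation and formal differentiation available.\<close>

definition elementary_symmetric :: "'b set \<Rightarrow> ('b \<Rightarrow> 'a::comm_ring_1) \<Rightarrow> nat \<Rightarrow> 'a" where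
  "elementary_symmetric A q k = coeff (\<Prod>a\<in>A. [:1, q a:]) k"

text \<open>The logarithmic derivative of \<open>\<Prod>\<^sub>a (1 + q\<^sub>a X)\<close> is \<open>\<Sum>\<^sub>a q\<^sub>a / (1 + q\<^sub>a X)\<close>.\<close>

lemma fps_deriv_prod_linear:
  fixes q :: "'b \<Rightarrow> 'a::field_char_0"
  assumes "finite A"
  shows "fps_deriv (fps_of_poly (\<Prod>a\<in>A. [:1, q a:])) =
    fps_of_poly (\<Prod>a\<in>A. [:1, q a:]) * (\<Sum>a\<in>A. Abs_fps (\<lambda>n. q a * (- q a) ^ n))"
  using assms
proof induction
  case empty
  show ?case by simp
next
  case (insert a A)
  let ?L = "fps_of_poly [:1, q a:]"
  let ?G = "Abs_fps (\<lambda>n. q a * (- q a) ^ n)"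
  have L: "?L = 1 + fps_const (q a) * fps_X"
    by (simp add: fps_of_poly_pCons)
  \<comment> \<open>\<open>?G\<close> is the geometric series of q_a / (1 + q_a X).\<close>
  have LG: "?L * ?G = fps_const (q a)"
    unfolding L by (rule fps_ext) (auto simp: distrib_right mult.assoc gr0_conv_Suc split: nat.splits)
  have "fps_deriv ?L = fps_const (q a)" unfolding L by simp
  then have L': "fps_deriv ?L = ?L * ?G" unfolding LG .
  show ?case
    unfolding prod.insert[OF insert.hyps] sum.insert[OF insert.hyps] fps_of_poly_mult fps_deriv_mult
      insert.IH L' by (simp only: algebra_simps)
qed

text \<open>Compare the coefficients of X^(k-1) in the equation for the logarithmic derivative; for
  \<open>k = 0\<close> both sides vanish.\<close>

lemma newton_identity:
  fixes q :: "'b \<Rightarrow> 'a::field_char_0"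
  assumes "finite A"
  shows "of_nat k * elementary_symmetric A q k =
    (\<Sum>r = 1..k. (- 1) ^ (r + 1) * (\<Sum>a\<in>A. q a ^ r) * elementary_symmetric A q (k - r))"
proof (cases k)
  case 0
  then show ?thesis by simp
next
  case (Suc n)
  let ?e = "elementary_symmetric A q"
  have "of_nat (Suc n) * ?e (Suc n) = fps_nth (fps_deriv (fps_of_poly (\<Prod>a\<in>A. [:1, q a:]))) n"
    by (simp add: elementary_symmetric_def)
  also have "\<dots> = (\<Sum>i = 0..n. ?e i * (\<Sum>a\<in>A. q a * (- q a) ^ (n - i)))"
    unfolding fps_deriv_prod_linear[OF assms]
    by (simp add: fps_mult_nth fps_sum_nth elementary_symmetric_def)
  also have "\<dots> = (\<Sum>r = 1..Suc n. (- 1) ^ (r + 1) * (\<Sum>a\<in>A. q a ^ r) * ?e (Suc n - r))"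
  \<comment> \<open>With \<open>r = Suc n - i\<close> the signs agree, because \<open>r + 1\<close>
    and \<open>n - i\<close> differ by 2.\<close>
  proof (rule sum.reindex_bij_witness[where i = "\<lambda>r. Suc n - r" and j = "\<lambda>i. Suc n - i"])
    fix i assume i: "i \<in> {0..n}"
    then have *: "Suc n - i = Suc (n - i)" by auto
    have **: "n - (n - i) = i" using i by auto
    have "q a * (- q a) ^ (n - i) = (- 1) ^ (n - i) * q a ^ Suc (n - i)" for a
      by (subst power_minus) (simp add: algebra_simps)
    then have "(\<Sum>a\<in>A. q a * (- q a) ^ (n - i)) = (- 1) ^ (n - i) * (\<Sum>a\<in>A. q a ^ Suc (n - i))"
      by (simp only: sum_distrib_left)
    then show "(- 1) ^ (Suc n - i + 1) * (\<Sum>a\<in>A. q a ^ (Suc n - i)) * ?e (Suc n - (Suc n - i)) =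
        ?e i * (\<Sum>a\<in>A. q a * (- q a) ^ (n - i))"
      by (simp add: * ** mult_ac)
  qed auto
  finally show ?thesis using Suc by simp
qed

lemma elementary_symmetric_0: "elementary_symmetric A q 0 = 1"
proof -
  have "poly (\<Prod>a\<in>A. [:1, q a:]) 0 = 1" by (simp add: poly_prod)
  then show ?thesis by (simp add: elementary_symmetric_def poly_0_coeff_0)
qed

lemma elementary_symmetric_1: "elementary_symmetric A q 1 = (\<Sum>a\<in>A. q a)"
proof (induction A rule: infinite_finite_induct)
  case (insert a A)
  then show ?case using elementary_symmetric_0[of A q] by (simp add: elementary_symmetric_def)
qed (simp_all add: elementary_symmetric_def)

text \<open>Through this, \<open>sigma_hat\<close> of the Fermat power sums is an integer in spite
  of the division by \<open>fact k\<close>.\<close>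

lemma elementary_symmetric_Ints:
  assumes "\<And>a. a \<in> A \<Longrightarrow> q a \<in> \<int>"
  shows "elementary_symmetric A q k \<in> \<int>"
  using assms
proof (induction A arbitrary: k rule: infinite_finite_induct)
  case (insert a A)
  then show ?case
    by (cases k) (auto simp: elementary_symmetric_def)
qed (simp_all add: elementary_symmetric_def)

lemma prod_one_plus_mult_eq:
  assumes "finite A"
  shows "(\<Prod>a\<in>A. 1 + t * q a) = (\<Sum>k = 0..card A. elementary_symmetric A q k * t ^ k)"
proof -
  let ?P = "\<Prod>a\<in>A. [:1, q a:]"
  have "degree ?P \<le> (\<Sum>a\<in>A. degree [:1, q a:])"
    using degree_prod_sum_le[OF assms, of "\<lambda>a. [:1, q a:]"] by (simp add: o_def)
  also have "\<dots> \<le> (\<Sum>a\<in>A. 1)" by (intro sum_mono) auto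
  finally have deg: "degree ?P \<le> card A" by simp
  have "(\<Prod>a\<in>A. 1 + t * q a) = poly ?P t" by (simp add: poly_prod)
  also have "\<dots> = (\<Sum>k = 0..card A. coeff ?P k * t ^ k)"
    unfolding poly_altdef using deg
    \<comment> \<open>If some \<open>q a\<close> is zero the degree falls below
      \<open>card A\<close>; the coefficients in between are zero.\<close>
    by (intro sum.mono_neutral_left) (auto simp: coeff_eq_0)
  finally show ?thesis by (simp add: elementary_symmetric_def)
qed

text \<open>The generating function behind this is exp (- \<Sum>r. \<pi>_r t^r / r) = \<Prod>a. (1 -
  q_a t), whose k-th coefficient is (-1)^k times the elementary symmetric polynomial.\<close>

lemma sigma_hat_power_sums:
  assumes "finite A" "1 \<le> k"
  shows "sigma_hat k (\<lambda>m. \<Sum>a\<in>A. q a ^ m) = elementary_symmetric A q k"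
proof -
  let ?\<pi> = "\<lambda>m. \<Sum>a\<in>A. q a ^ m"
  \<comment> \<open>For \<open>r \<ge> 1\<close> this is - \<pi>_r / r, the argument that
    \<open>complete_bell_eq_exp_coeff\<close> produces from \<open>sigma_hat\<close>.\<close>
  define x where "x = (\<lambda>r. - (fact (r - 1) * ?\<pi> r) / fact r)"
  have x: "of_nat r * x r = - ?\<pi> r" if "1 \<le> r" for r
    using that by (cases r) (simp_all add: x_def del: of_nat_Suc)
  \<comment> \<open>The bound \<open>N = k\<close> stays fixed while \<open>m\<close> varies: the
    recurrence refers to all smaller coefficients for the same bound.\<close>
  have "m \<le> k \<Longrightarrow> (- 1) ^ m * exp_coeff k x m = elementary_symmetric A q m" for m
  proof (induction m rule: less_induct)
    case (less m)
    show ?case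
    proof (cases "m = 0")
      case True
      then show ?thesis by (simp add: exp_coeff_0 elementary_symmetric_0)
    next
      case False
      have "of_nat m * ((- 1) ^ m * exp_coeff k x m) = (- 1) ^ m * (of_nat m * exp_coeff k x m)"
        by simp
      also have "\<dots> = (\<Sum>r = 1..m. (- 1) ^ m * (of_nat r * x r * exp_coeff k x (m - r)))"
        unfolding exp_coeff_recurrence[OF less.prems] sum_distrib_left ..
      also have "\<dots> = (\<Sum>r = 1..m. (- 1) ^ (r + 1) * ?\<pi> r * elementary_symmetric A q (m - r))"
      proof (rule sum.cong[OF refl])
        fix r assume r: "r \<in> {1..m}"
        have "elementary_symmetric A q (m - r) = (- 1) ^ (m - r) * exp_coeff k x (m - r)"
          using less.IH[of "m - r"] less.prems r by simp
        moreover have "((- 1) ^ m :: rat) = (- 1) ^ r * (- 1) ^ (m - r)"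
          using r by (simp flip: power_add)
        moreover have "of_nat r * x r = - ?\<pi> r" using x r by simp
        ultimately show "(- 1) ^ m * (of_nat r * x r * exp_coeff k x (m - r)) =
            (- 1) ^ (r + 1) * ?\<pi> r * elementary_symmetric A q (m - r)"
          by (simp add: mult_ac)
      qed
      also have "\<dots> = of_nat m * elementary_symmetric A q m"
        using newton_identity[OF assms(1), of m q] by simp
      finally show ?thesis using False by simp
    qed
  qed
  from this[of k] show ?thesis
    unfolding sigma_hat_def complete_bell_eq_exp_coeff[OF assms(2) order_refl] x_def by simp
qed

section \<open>The fixed-point equation of the Wilson quotient\<close>

lemma wilson_quotient_Ints:
  assumes "prime p"
  shows "wilson_quotient p \<in> \<int>"
proof -
  have "int p dvd fact (p - 1) + 1"
    using wilson_theorem[OF assms] by (simp add: cong_iff_dvd_diff)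
  then obtain c where "(fact (p - 1) :: int) + 1 = int p * c" by (elim dvdE)
  then have "(of_int (fact (p - 1) + 1) :: rat) = of_int (int p * c)" by (simp only:)
  then have "wilson_quotient p = of_int c"
    using prime_gt_0_nat[OF assms] by (simp add: wilson_quotient_def field_simps)
  then show ?thesis by simp
qed

lemma fermat_quotient_Ints:
  assumes "prime p" "a \<in> {1..p - 1}"
  shows "fermat_quotient p a \<in> \<int>"
proof -
  have "\<not> p dvd a" using assms(2) by (auto dest: dvd_imp_le)
  then have "[a ^ (p - 1) = 1] (mod p)" by (rule fermat_theorem[OF assms(1)])
  then have "[int (a ^ (p - 1)) = int 1] (mod int p)" by (simp only: cong_int_iff)
  then have "int p dvd int a ^ (p - 1) - 1" by (simp add: cong_iff_dvd_diff)
  then obtain c where "int a ^ (p - 1) - 1 = int p * c" by (elim dvdE)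
  then have "(of_int (int a ^ (p - 1) - 1) :: rat) = of_int (int p * c)" by (simp only:)
  then have "fermat_quotient p a = of_int c"
    using prime_gt_0_nat[OF assms(1)] by (simp add: fermat_quotient_def field_simps)
  then show ?thesis by simp
qed

lemma fermat_wilson_product:
  assumes "odd p"
  shows "(\<Prod>a = 1..p - 1. 1 + of_nat p * fermat_quotient p a) =
    (1 - of_nat p * wilson_quotient p) ^ (p - 1)"
proof -
  have "p > 0" using assms by (cases p) auto
  then have "(\<Prod>a = 1..p - 1. 1 + of_nat p * fermat_quotient p a) =
      (\<Prod>a = 1..p - 1. of_nat a ^ (p - 1) :: rat)"
    by (intro prod.cong) (auto simp: fermat_quotient_def)
  also have "\<dots> = fact (p - 1) ^ (p - 1)"
    by (simp add: fact_prod prod_power_distrib)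
  \<comment> \<open>The exponent \<open>p - 1\<close> is even, so the sign can be inserted to reach
    the base 1 - p W.\<close>
  also have "\<dots> = (- fact (p - 1)) ^ (p - 1)"
    using assms by (simp add: power_minus_even)
  also have "- fact (p - 1) = 1 - of_nat p * wilson_quotient p"
    using \<open>p > 0\<close> by (simp add: wilson_quotient_def)
  finally show ?thesis .
qed

text \<open>An exact identity of rationals. Both expansions reach the power
  \<open>p ^ (p - 1)\<close>, and one factor \<open>p\<close> is divided out, whence the upper limit
  \<open>p - 2\<close>.\<close>

lemma wilson_quotient_fixed_point:
  fixes p :: nat
  defines "W \<equiv> wilson_quotient p"
  assumes "odd p" "p > 1"
  shows "W = fermat_power_sum p 1 + of_nat p * W +
    (\<Sum>\<nu> = 1..p - 2. of_nat p ^ \<nu> * (sigma_hat (\<nu> + 1) (fermat_power_sum p) +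
       of_nat ((p - 1) choose (\<nu> + 1)) * (- 1) ^ \<nu> * W ^ (\<nu> + 1)))"
proof -
  let ?e = "elementary_symmetric {1..p - 1} (fermat_quotient p)"
  let ?c = "\<lambda>k. of_nat ((p - 1) choose k) * (- 1) ^ k * W ^ k"
  \<comment> \<open>The difference of the coefficients of \<open>p ^ k\<close> in the two
    expansions.\<close>
  define d where "d = (\<lambda>k. ?e k - ?c k)"
  have sig: "sigma_hat k (fermat_power_sum p) = ?e k" if "1 \<le> k" for k
    using sigma_hat_power_sums[of "{1..p - 1}" k "fermat_quotient p"] that
    by (simp add: fermat_power_sum_def[abs_def])
  have "(\<Sum>k = 0..p - 1. ?e k * of_nat p ^ k) = (1 + of_nat p * (- W)) ^ (p - 1)"
    using fermat_wilson_product[OF assms(2)]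
      prod_one_plus_mult_eq[of "{1..p - 1}" "of_nat p" "fermat_quotient p"]
    by (simp add: W_def)
  also have "\<dots> = (\<Sum>k = 0..p - 1. ?c k * of_nat p ^ k)"
    by (subst add.commute, subst binomial_ring)
       (auto intro!: sum.cong simp: atMost_atLeast0 power_mult_distrib power_minus[of W]
         power_minus[of "of_nat p * W"])
  finally have "(\<Sum>k = 0..p - 1. d k * of_nat p ^ k) = 0"
    by (simp add: d_def left_diff_distrib sum_subtractf)
  \<comment> \<open>Both constant terms are 1; once they cancel, a factor \<open>p\<close> can be
    divided out and \<open>k = \<nu> + 1\<close>.\<close>
  moreover have "d 0 = 0" by (simp add: d_def elementary_symmetric_0)
  moreover have "{0..p - 1} = insert 0 {Suc 0..Suc (p - 2)}" using assms by auto
  ultimately have "(\<Sum>k = Suc 0..Suc (p - 2). d k * of_nat p ^ k) = 0" by simp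
  then have "of_nat p * (\<Sum>\<nu> = 0..p - 2. d (\<nu> + 1) * of_nat p ^ \<nu>) = 0"
    by (subst (asm) sum.shift_bounds_cl_Suc_ivl) (simp add: sum_distrib_left mult_ac)
  then have "(\<Sum>\<nu> = 0..p - 2. d (\<nu> + 1) * of_nat p ^ \<nu>) = 0" using assms by simp
  moreover have "{0..p - 2} = insert 0 {1..p - 2}" by auto
  ultimately have "d 1 + (\<Sum>\<nu> = 1..p - 2. d (\<nu> + 1) * of_nat p ^ \<nu>) = 0" by simp
  \<comment> \<open>The linear binomial coefficient is \<open>p - 1\<close>. Its part
    \<open>- W\<close> becomes the left side of the fixed-point equation.\<close>
  moreover have "d 1 = fermat_power_sum p 1 + of_nat p * W - W"
    using assms elementary_symmetric_1[of "{1..p - 1}" "fermat_quotient p"]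
    by (simp add: d_def fermat_power_sum_def of_nat_diff algebra_simps)
  moreover have "(\<Sum>\<nu> = 1..p - 2. d (\<nu> + 1) * of_nat p ^ \<nu>) =
      (\<Sum>\<nu> = 1..p - 2. of_nat p ^ \<nu> * (sigma_hat (\<nu> + 1) (fermat_power_sum p) +
       of_nat ((p - 1) choose (\<nu> + 1)) * (- 1) ^ \<nu> * W ^ (\<nu> + 1)))"
    by (intro sum.cong refl) (simp add: d_def sig algebra_simps)
  ultimately show ?thesis by (simp add: algebra_simps)
qed

text \<open>By \<open>l < p\<close> the sum up to \<open>l - 1\<close> is an initial segment of the
  full one, and every later term is an integer multiple of \<open>p ^ l\<close>.\<close>

lemma wilson_quotient_truncated:
  fixes p l :: nat
  defines "W \<equiv> wilson_quotient p"
  assumes "prime p" "odd p" "l < p"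
  shows "p_cong p l W (fermat_power_sum p 1 + of_nat p * W +
    (\<Sum>\<nu> = 1..l - 1. of_nat p ^ \<nu> * (sigma_hat (\<nu> + 1) (fermat_power_sum p) +
       of_nat ((p - 1) choose (\<nu> + 1)) * (- 1) ^ \<nu> * W ^ (\<nu> + 1))))"
proof -
  define s where "s = (\<lambda>\<nu>. sigma_hat (\<nu> + 1) (fermat_power_sum p) +
       of_nat ((p - 1) choose (\<nu> + 1)) * (- 1) ^ \<nu> * W ^ (\<nu> + 1))"
  have W: "W \<in> \<int>" unfolding W_def by (rule wilson_quotient_Ints) fact
  have s: "p_integral p (s \<nu>)" for \<nu>
  proof -
    have "sigma_hat (\<nu> + 1) (fermat_power_sum p) =
        elementary_symmetric {1..p - 1} (fermat_quotient p) (\<nu> + 1)"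
      using sigma_hat_power_sums[of "{1..p - 1}" "\<nu> + 1" "fermat_quotient p"]
      by (simp add: fermat_power_sum_def[abs_def])
    also have "\<dots> \<in> \<int>" by (intro elementary_symmetric_Ints fermat_quotient_Ints assms)
    finally show ?thesis
      unfolding s_def using W by (intro p_integral_Ints Ints_add Ints_mult Ints_power) auto
  qed
  \<comment> \<open>The maximum covers \<open>l = 0\<close>, where the first range is empty and the
    tail must still start at 1.\<close>
  have "{1..p - 2} = {1..l - 1} \<union> {max 1 l..p - 2}" using assms by auto
  then have "(\<Sum>\<nu> = 1..p - 2. of_nat p ^ \<nu> * s \<nu>) =
      (\<Sum>\<nu> = 1..l - 1. of_nat p ^ \<nu> * s \<nu>) + (\<Sum>\<nu> = max 1 l..p - 2. of_nat p ^ \<nu> * s \<nu>)"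
    by (simp only:) (rule sum.union_disjoint, auto)
  moreover have "p_cong p l (\<Sum>\<nu> = max 1 l..p - 2. of_nat p ^ \<nu> * s \<nu>)
      (\<Sum>\<nu> = max 1 l..p - 2. 0)"
    by (intro p_cong_sum p_cong_0_p_power_mult s) auto
  ultimately have "p_cong p l
      (fermat_power_sum p 1 + of_nat p * W + (\<Sum>\<nu> = 1..p - 2. of_nat p ^ \<nu> * s \<nu>))
      (fermat_power_sum p 1 + of_nat p * W + ((\<Sum>\<nu> = 1..l - 1. of_nat p ^ \<nu> * s \<nu>) + 0))"
    by (simp only: sum.neutral_const) (intro p_cong_add p_cong_refl)
  then show ?thesis
    using wilson_quotient_fixed_point[of p] assms(3) prime_gt_1_nat[OF assms(2)]
    unfolding s_def W_def by simp
qed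

section \<open>Strong induction on the precision\<close>

theorem theorem3p2:
  fixes n p :: nat and w :: "nat \<Rightarrow> rat"
  assumes "n \<ge> 2"
    and "prime p" and "odd p" and "p > n"
    and "\<And>l. l \<in> {1..n} \<Longrightarrow> p_integral p (w l)"
    and "p_cong p 1 (w 1) (fermat_power_sum p 1)"
    and "\<And>l. l \<in> {2..n} \<Longrightarrow>
      p_cong p l (w l)
        (fermat_power_sum p 1 + of_nat p * w (l - 1) +
         (\<Sum>\<nu> = 1..l - 1. of_nat p ^ \<nu> *
            (sigma_hat (\<nu> + 1) (fermat_power_sum p) +
             of_nat ((p - 1) choose (\<nu> + 1)) * (- 1) ^ \<nu> * w (l - \<nu>) ^ (\<nu> + 1))))"
  shows "p_cong p n (wilson_quotient p) (w n)"
proof -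
  let ?W = "wilson_quotient p"
  have W: "p_integral p ?W"
    using assms(2) by (intro p_integral_Ints wilson_quotient_Ints)
  \<comment> \<open>Strong induction, since the recursion for \<open>w l\<close> refers to all of
    \<open>w 1\<close> up to \<open>w (l - 1)\<close>.\<close>
  have "l \<in> {1..n} \<Longrightarrow> p_cong p l ?W (w l)" for l
  proof (induction l rule: less_induct)
    case (less l)
    have trunc: "p_cong p l ?W (fermat_power_sum p 1 + of_nat p * ?W +
        (\<Sum>\<nu> = 1..l - 1. of_nat p ^ \<nu> * (sigma_hat (\<nu> + 1) (fermat_power_sum p) +
           of_nat ((p - 1) choose (\<nu> + 1)) * (- 1) ^ \<nu> * ?W ^ (\<nu> + 1))))"
      using less.prems assms by (intro wilson_quotient_truncated) auto
    show ?case
    proof (cases "l = 1")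
      case True
      \<comment> \<open>For \<open>l = 1\<close> the truncated sum is empty, and only p W remains to
        be removed.\<close>
      have "p_cong p 1 (of_nat p ^ 1 * ?W) 0" by (rule p_cong_0_p_power_mult) (simp_all add: W)
      then have "p_cong p 1 (fermat_power_sum p 1 + of_nat p ^ 1 * ?W) (fermat_power_sum p 1 + 0)"
        by (intro p_cong_add p_cong_refl)
      moreover have "p_cong p 1 ?W (fermat_power_sum p 1 + of_nat p ^ 1 * ?W)"
        using trunc True by simp
      ultimately have "p_cong p 1 ?W (fermat_power_sum p 1)"
        using p_cong_trans by fastforce
      then show ?thesis
        using True p_cong_trans p_cong_sym[OF assms(6)] by blast
    next
      case False
      then have l: "l \<in> {2..n}" using less.prems by auto
      have step: "p_cong p l (of_nat p ^ \<nu> * x) (of_nat p ^ \<nu> * y)"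
        if "p_cong p (l - \<nu>) x y" "\<nu> < l" for \<nu> x y
        using p_cong_p_power_mult[OF that(1), of \<nu>] that(2) by simp
      have pow: "p_cong p (l - \<nu>) (?W ^ k) (w (l - \<nu>) ^ k)" if "\<nu> \<in> {1..l - 1}" for \<nu> k
        using that less.prems by (intro p_cong_power less.IH W assms(5)) auto
      \<comment> \<open>Written with the exponent 1, the linear term is covered by
        \<open>step\<close> with \<open>\<nu> = 1\<close>.\<close>
      have "p_cong p l (of_nat p ^ 1 * ?W) (of_nat p ^ 1 * w (l - 1))"
        using l pow[of 1 1] by (intro step) auto
      then have lin: "p_cong p l (of_nat p * ?W) (of_nat p * w (l - 1))" by simp
      have "p_cong p l (fermat_power_sum p 1 + of_nat p * ?W +
          (\<Sum>\<nu> = 1..l - 1. of_nat p ^ \<nu> * (sigma_hat (\<nu> + 1) (fermat_power_sum p) +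
             of_nat ((p - 1) choose (\<nu> + 1)) * (- 1) ^ \<nu> * ?W ^ (\<nu> + 1))))
          (fermat_power_sum p 1 + of_nat p * w (l - 1) +
          (\<Sum>\<nu> = 1..l - 1. of_nat p ^ \<nu> * (sigma_hat (\<nu> + 1) (fermat_power_sum p) +
             of_nat ((p - 1) choose (\<nu> + 1)) * (- 1) ^ \<nu> * w (l - \<nu>) ^ (\<nu> + 1))))"
      proof (intro p_cong_add p_cong_refl lin p_cong_sum step)
        fix \<nu> assume \<nu>: "\<nu> \<in> {1..l - 1}"
        then show "\<nu> < l" by auto
        have "p_integral p (w (l - \<nu>))" using \<nu> less.prems by (intro assms(5)) auto
        then show "p_cong p (l - \<nu>) (of_nat ((p - 1) choose (\<nu> + 1)) * (- 1) ^ \<nu> * ?W ^ (\<nu> + 1))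
            (of_nat ((p - 1) choose (\<nu> + 1)) * (- 1) ^ \<nu> * w (l - \<nu>) ^ (\<nu> + 1))"
          using \<nu>
          by (intro p_cong_mult[OF p_cong_refl] pow p_integral_power) (auto intro: p_integral_Ints)
      qed
      then show ?thesis
        using trunc p_cong_sym[OF assms(7)[OF l]] p_cong_trans by blast
    qed
  qed
  then show ?thesis using assms(1) by simp
qed

end
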